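(* Consider the convex program $\min_x f(x)$ s.t. $g(x)\le 0$, $Ax=b$ and its augmented primal-dual gradient dynamics (Aug-PDGD) with parameter $\rho>0$, as defined in the context, and suppose Assumptions 1, 2 and 3 listed in the context hold. Then the KKT point $z^\ast=(x^\ast,\lambda^\ast,\nu^\ast)$ is a semi-globally exponentially stable equilibrium of the Aug-PDGD (under the restriction $\lambda(0)\ge 0$); that is, $z^\ast$ is an equilibrium point and for every $h>0$ there exist $M>0$ and $\beta>0$ such that every trajectory $z(t)=(x(t),\lambda(t),\nu(t))$ of the Aug-PDGD with $\lambda(0)\ge0$ and $\|z(0)-z^\ast\|\le h$ satisfies $$\|z(t)-z^\ast\|\le M e^{-\beta t}\|z(0)-z^\ast\|\qquad\text{for all } t\ge 0.$$
   Context: Notation: $[u]_+=\max\{u,0\}$; $\|\cdot\|$ is the Euclidean norm; vector inequalities are entrywise; $e_i$ is the $i$-th standard basis vector of $\mathbb R^{m_I}$. Problem: $\min_{x\in\mathbb R^n} f(x)$ subject to $g(x)\le 0$ and $Ax=b$, where $f:\mathbb R^n\to\mathbb R$ is continuously differentiable and convex, $g=(g_1,\dots,g_{m_I}):\mathbb R^n\to\mathbb R^{m_I}$ is continuously differentiable with each $g_i$ convex, $A\in\mathbb R^{m_E\times n}$, $b\in\mathbb R^{m_E}$. Aug-PDGD with parameter $\rho>0$: a trajectory is a differentiable curve $z(t)=(x(t),\lambda(t),\nu(t))\in\mathbb R^n\times\mathbb R^{m_I}\times\mathbb R^{m_E}$, $t\ge0$, satisfying for all $t\ge 0$ $$\dot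 x=-\nabla f(x)-A^T\nu-\sum_{i=1}^{m_I}[\rho g_i(x)+\lambda_i]_+\nabla g_i(x),\qquad \dot\lambda=\sum_{i=1}^{m_I}\frac{[\rho g_i(x)+\lambda_i]_+-\lambda_i}{\rho}e_i,\qquad \dot\nu=Ax-b .$$ Assumption 1: the problem is feasible and $f$ is $\mu$-strongly convex ($\mu>0$). Denote by $x^\ast$ the unique optimal solution and by $\mathcal I=\{i: g_i(x^\ast)=0\}$ the active set. Assumption 2 (LICQ): the vectors $\nabla g_i(x^\ast)$, $i\in\mathcal I$, together with the rows of $A$, are linearly independent, and $|\mathcal I|+m_E>0$. Consequently there are unique multipliers $\lambda^\ast,\nu^\ast$ such that $z^\ast=(x^\ast,\lambda^\ast,\nu^\ast)$ satisfies the KKT conditions. Assumption 3: $\nabla f$ is $\ell$-Lipschitz continuous; and for any $d_0$ (the initial distance $d_0=\|z(0)-z^\ast\|$) there exist $L_{g,i}\ge0$, $M_{g,i}\ge 0$ (chosen non-decreasing as functions of $d_0$) such that, for each $i=1,\dots,m_I$, $\|\nabla g_i(x)\|\le L_{g,i}$ and $\nabla g_i$ is $M_{g,i}$-Lipschitz continuous on $\{x:\|x-x^\ast\|\le d_0\}$. *)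

theory Defs
  imports "HOL-Analysis.Analysis"
begin

text \<open>
  The numbers mI and mE of inequality and equality constraints may be zero, which index types
  would exclude. Hence constraints are indexed by the sets \<open>{1..mI}\<close> and \<open>{1..mE}\<close> of natural
  numbers, and vectors of multipliers are functions on the naturals of which only the
  components in these sets are ever used. The matrix of the equality constraints is given by its
  rows \<open>A j\<close>, so that the components of \<open>A x\<close> are \<open>A j \<bullet> x\<close>.
\<close>

type_synonym 'n pd_point = "(real ^ 'n) \<times> (nat \<Rightarrow> real) \<times> (nat \<Rightarrow> real)"

definition has_continuous_gradient ::
    "('a :: real_inner \<Rightarrow> real) \<Rightarrow> ('a \<Rightarrow> 'a) \<Rightarrow> bool" where
  "has_continuous_gradient f Df \<longleftrightarrow> (\<forall>x. GDERIV f x :> Df x) \<and> continuous_on UNIV Df"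

definition strongly_convex :: "real \<Rightarrow> ('a :: real_normed_vector \<Rightarrow> real) \<Rightarrow> bool" where
  "strongly_convex \<mu> f \<longleftrightarrow>
     (\<forall>x y. \<forall>t\<in>{0..1}. f ((1 - t) *\<^sub>R x + t *\<^sub>R y)
        \<le> (1 - t) * f x + t * f y - \<mu> / 2 * t * (1 - t) * (norm (x - y))\<^sup>2)"

definition feasible_set ::
    "nat \<Rightarrow> (nat \<Rightarrow> real ^ 'n \<Rightarrow> real) \<Rightarrow> nat \<Rightarrow> (nat \<Rightarrow> real ^ 'n) \<Rightarrow> (nat \<Rightarrow> real) \<Rightarrow> (real ^ 'n) set"
  where
  "feasible_set mI g mE A b =
     {x. (\<forall>i\<in>{1..mI}. g i x \<le> 0) \<and> (\<forall>j\<in>{1..mE}. A j \<bullet> x = b j)}"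

definition active_set :: "nat \<Rightarrow> (nat \<Rightarrow> real ^ 'n \<Rightarrow> real) \<Rightarrow> real ^ 'n \<Rightarrow> nat set" where
  "active_set mI g x = {i \<in> {1..mI}. g i x = 0}"

definition lin_indep_family :: "('k \<Rightarrow> 'a :: real_vector) \<Rightarrow> 'k set \<Rightarrow> bool" where
  "lin_indep_family v K \<longleftrightarrow> inj_on v K \<and> independent (v ` K)"

definition LICQ ::
    "nat \<Rightarrow> (nat \<Rightarrow> real ^ 'n \<Rightarrow> real) \<Rightarrow> (nat \<Rightarrow> real ^ 'n \<Rightarrow> real ^ 'n) \<Rightarrow>
     nat \<Rightarrow> (nat \<Rightarrow> real ^ 'n) \<Rightarrow> real ^ 'n \<Rightarrow> bool" where
  "LICQ mI g Dg mE A x \<longleftrightarrow>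
     lin_indep_family (case_sum (\<lambda>i. Dg i x) A) (active_set mI g x <+> {1..mE})"

fun KKT ::
    "(real ^ 'n \<Rightarrow> real ^ 'n) \<Rightarrow> nat \<Rightarrow> (nat \<Rightarrow> real ^ 'n \<Rightarrow> real) \<Rightarrow>
     (nat \<Rightarrow> real ^ 'n \<Rightarrow> real ^ 'n) \<Rightarrow> nat \<Rightarrow> (nat \<Rightarrow> real ^ 'n) \<Rightarrow> (nat \<Rightarrow> real) \<Rightarrow>
     'n pd_point \<Rightarrow> bool" where
  "KKT Df mI g Dg mE A b (x, lam, nu) \<longleftrightarrow>
     Df x + (\<Sum>j\<in>{1..mE}. nu j *\<^sub>R A j) + (\<Sum>i\<in>{1..mI}. lam i *\<^sub>R Dg i x) = 0 \<and>
     x \<in> feasible_set mI g mE A b \<and>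
     (\<forall>i\<in>{1..mI}. 0 \<le> lam i \<and> lam i * g i x = 0)"

text \<open>PDGD stands for the augmented primal-dual gradient dynamics with parameter \<open>\<rho>\<close>; the multiplier
  components of its right-hand side, and the derivatives in a trajectory, are taken componentwise.\<close>

fun pdgd_x ::
    "real \<Rightarrow> (real ^ 'n \<Rightarrow> real ^ 'n) \<Rightarrow> nat \<Rightarrow> (nat \<Rightarrow> real ^ 'n \<Rightarrow> real) \<Rightarrow>
     (nat \<Rightarrow> real ^ 'n \<Rightarrow> real ^ 'n) \<Rightarrow> nat \<Rightarrow> (nat \<Rightarrow> real ^ 'n) \<Rightarrow> 'n pd_point \<Rightarrow> real ^ 'n" where
  "pdgd_x \<rho> Df mI g Dg mE A (x, lam, nu) =
     - Df x - (\<Sum>j\<in>{1..mE}. nu j *\<^sub>R A j)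
     - (\<Sum>i\<in>{1..mI}. max (\<rho> * g i x + lam i) 0 *\<^sub>R Dg i x)"

fun pdgd_lambda ::
    "real \<Rightarrow> (nat \<Rightarrow> real ^ 'n \<Rightarrow> real) \<Rightarrow> 'n pd_point \<Rightarrow> nat \<Rightarrow> real" where
  "pdgd_lambda \<rho> g (x, lam, nu) i = (max (\<rho> * g i x + lam i) 0 - lam i) / \<rho>"

fun pdgd_nu ::
    "(nat \<Rightarrow> real ^ 'n) \<Rightarrow> (nat \<Rightarrow> real) \<Rightarrow> 'n pd_point \<Rightarrow> nat \<Rightarrow> real" where
  "pdgd_nu A b (x, lam, nu) j = A j \<bullet> x - b j"

definition pdgd_equilibrium ::
    "real \<Rightarrow> (real ^ 'n \<Rightarrow> real ^ 'n) \<Rightarrow> nat \<Rightarrow> (nat \<Rightarrow> real ^ 'n \<Rightarrow> real) \<Rightarrow>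
     (nat \<Rightarrow> real ^ 'n \<Rightarrow> real ^ 'n) \<Rightarrow> nat \<Rightarrow> (nat \<Rightarrow> real ^ 'n) \<Rightarrow> (nat \<Rightarrow> real) \<Rightarrow>
     'n pd_point \<Rightarrow> bool" where
  "pdgd_equilibrium \<rho> Df mI g Dg mE A b z \<longleftrightarrow>
     pdgd_x \<rho> Df mI g Dg mE A z = 0 \<and>
     (\<forall>i\<in>{1..mI}. pdgd_lambda \<rho> g z i = 0) \<and>
     (\<forall>j\<in>{1..mE}. pdgd_nu A b z j = 0)"

definition pdgd_trajectory ::
    "real \<Rightarrow> (real ^ 'n \<Rightarrow> real ^ 'n) \<Rightarrow> nat \<Rightarrow> (nat \<Rightarrow> real ^ 'n \<Rightarrow> real) \<Rightarrow>
     (nat \<Rightarrow> real ^ 'n \<Rightarrow> real ^ 'n) \<Rightarrow> nat \<Rightarrow> (nat \<Rightarrow> real ^ 'n) \<Rightarrow> (nat \<Rightarrow> real) \<Rightarrow>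
     (real \<Rightarrow> real ^ 'n) \<Rightarrow> (real \<Rightarrow> nat \<Rightarrow> real) \<Rightarrow> (real \<Rightarrow> nat \<Rightarrow> real) \<Rightarrow> bool" where
  "pdgd_trajectory \<rho> Df mI g Dg mE A b x lam nu \<longleftrightarrow>
     (\<forall>t\<ge>0.
        (x has_vector_derivative pdgd_x \<rho> Df mI g Dg mE A (x t, lam t, nu t)) (at t within {0..}) \<and>
        (\<forall>i\<in>{1..mI}. ((\<lambda>s. lam s i) has_real_derivative pdgd_lambda \<rho> g (x t, lam t, nu t) i)
                        (at t within {0..})) \<and>
        (\<forall>j\<in>{1..mE}. ((\<lambda>s. nu s j) has_real_derivative pdgd_nu A b (x t, lam t, nu t) j)
                        (at t within {0..})))"

fun pd_dist :: "nat \<Rightarrow> nat \<Rightarrow> ('n::finite) pd_point \<Rightarrow> 'n pd_point \<Rightarrow> real" where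
  "pd_dist mI mE (x, lam, nu) (x', lam', nu') =
     sqrt ((norm (x - x'))\<^sup>2 + (\<Sum>i\<in>{1..mI}. (lam i - lam' i)\<^sup>2) + (\<Sum>j\<in>{1..mE}. (nu j - nu' j)\<^sup>2))"

end

theory Submission
  imports Defs
begin

text \<open>
  The squared distance \<open>N\<close> to the KKT point is non-increasing along trajectories. Convexity of the
  constraints turns the coupling between \<open>x\<close> and the multipliers into an expression in
  \<open>[\<rho> g\<^sub>i(x) + \<lambda>\<^sub>i]\<^sub>+\<close> alone, and firm nonexpansiveness of the positive part bounds it, so that
  \<open>N' \<le> - m D\<^sup>2\<close> where the defect \<open>D\<close> combines the error of \<open>x\<close> with the velocity of \<open>\<lambda>\<close>
  (\<open>dissipation\<close>). Hence a trajectory stays in the ball around the KKT point on which it starts,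
  and the local bounds on the constraint gradients hold uniformly in time.

  This dissipation is degenerate: \<open>D\<close> does not see the errors of \<open>\<nu>\<close> and of the active \<open>\<lambda>\<^sub>i\<close>. An
  inactive \<open>\<lambda>\<^sub>i\<close> is seen (\<open>inactive_multiplier_bound\<close>), because at \<open>x*\<close> it can only be at rest at 0. The
  remaining errors act on \<open>x\<close> through the force \<open>P = \<Sum> (\<lambda>\<^sub>i - \<lambda>\<^sub>i*) \<nabla>g\<^sub>i(x*) + A\<^sup>T(\<nu> - \<nu>*)\<close>,
  summed over active \<open>i\<close>, and LICQ says that \<open>P\<close> determines them, so \<open>N \<le> K (D\<^sup>2 + |P|\<^sup>2)\<close>
  (\<open>dist_le_defect_force\<close>). Moreover \<open>x' = - P + O(D)\<close> and \<open>P' = O(D)\<close>. Writing \<open>y = x - x*\<close>,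
  the derivative of the cross term \<open>y \<bullet> P\<close> is therefore at most \<open>- |P|\<^sup>2 / 2 + O(D\<^sup>2)\<close>, and
  \<open>N + \<epsilon> (y \<bullet> P)\<close> with small \<open>\<epsilon>\<close> is comparable to \<open>N\<close> and decays exponentially
  (\<open>decay_by_cross_term\<close>). All constants depend only on the radius of the initial ball.
\<close>

section \<open>Strong convexity and linear independence\<close>

text \<open>The difference quotients of \<open>f\<close> at \<open>x\<close> in direction \<open>y - x\<close> are bounded by the defining
  inequality of strong convexity; let the step tend to 0. The case \<open>\<mu> = 0\<close> serves the merely convex
  constraint functions.\<close>

lemma gradient_lower_bound:
  fixes f :: "'a :: real_inner \<Rightarrow> real"
  assumes "strongly_convex \<mu> f" and "GDERIV f x :> D"
  shows "f x + D \<bullet> (y - x) + \<mu> / 2 * (norm (y - x))\<^sup>2 \<le> f y"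
proof -
  let ?p = "\<lambda>t :: real. f (x + t *\<^sub>R (y - x))"
  have "(f has_derivative (\<lambda>h. h \<bullet> D)) (at (x + 0 *\<^sub>R (y - x)))"
    using assms(2) by (simp add: gderiv_def)
  then have "(?p has_derivative (\<lambda>t. (t *\<^sub>R (y - x)) \<bullet> D)) (at 0)"
    by (rule has_derivative_compose[rotated]) (auto intro!: derivative_eq_intros)
  then have "(?p has_real_derivative D \<bullet> (y - x)) (at 0)"
    unfolding has_field_derivative_def
    by (rule has_derivative_eq_rhs) (simp add: fun_eq_iff inner_commute mult.commute)
  then have "((\<lambda>t. (?p t - ?p 0) / t) \<longlongrightarrow> D \<bullet> (y - x)) (at_right 0)"
    by (auto simp: has_field_derivative_iff intro: filterlim_at_split[THEN iffD1, THEN conjunct2])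
  moreover have "((\<lambda>t. f y - f x - \<mu> / 2 * (1 - t) * (norm (y - x))\<^sup>2)
      \<longlongrightarrow> f y - f x - \<mu> / 2 * (1 - 0) * (norm (y - x))\<^sup>2) (at_right 0)"
    by (intro tendsto_intros)
  moreover have "\<forall>\<^sub>F t in at_right 0. (?p t - ?p 0) / t
      \<le> f y - f x - \<mu> / 2 * (1 - t) * (norm (y - x))\<^sup>2"
    unfolding eventually_at_right_field
  proof (intro exI[of _ 1] conjI allI impI)
    fix t :: real
    assume t: "0 < t" "t < 1"
    have "?p t = f ((1 - t) *\<^sub>R x + t *\<^sub>R y)"
      by (simp add: algebra_simps)
    also have "\<dots> \<le> (1 - t) * f x + t * f y - \<mu> / 2 * t * (1 - t) * (norm (x - y))\<^sup>2"
      using assms(1) t unfolding strongly_convex_def by simp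
    finally have "?p t - ?p 0 \<le> t * (f y - f x - \<mu> / 2 * (1 - t) * (norm (y - x))\<^sup>2)"
      by (simp add: algebra_simps norm_minus_commute)
    then show "(?p t - ?p 0) / t \<le> f y - f x - \<mu> / 2 * (1 - t) * (norm (y - x))\<^sup>2"
      using t by (simp add: pos_divide_le_eq mult.commute)
  qed simp
  ultimately have "D \<bullet> (y - x) \<le> f y - f x - \<mu> / 2 * (1 - 0) * (norm (y - x))\<^sup>2"
    by (intro tendsto_le[rotated 2]) auto
  then show ?thesis
    by simp
qed

lemma convex_on_imp_strongly_convex_0: "convex_on UNIV f \<Longrightarrow> strongly_convex 0 f"
  unfolding strongly_convex_def convex_on_def by auto

lemma positive_part_firmly_nonexpansive:
  fixes u v :: real
  shows "(max u 0 - max v 0)\<^sup>2 \<le> (max u 0 - max v 0) * (u - v)"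
proof -
  \<comment> \<open>The difference of the two sides: a number is its positive part minus its negative part, and
    the product of the two parts vanishes.\<close>
  have "0 \<le> max u 0 * max (- v) 0 + max v 0 * max (- u) 0"
    by simp
  then show ?thesis
    by (auto simp: max_def power2_eq_square algebra_simps mult_nonneg_nonpos
        mult_nonneg_nonpos2 split: if_splits)
qed

text \<open>Each coefficient is the value at the sum of a linear functional that is 1 on one vector of
  the family and 0 on the others, and linear functionals are bounded in finite dimension.\<close>

lemma lin_indep_family_coeff_bound:
  fixes v :: "'k \<Rightarrow> 'a :: euclidean_space"
  assumes "lin_indep_family v I" and "finite I"
  obtains B where "B > 0"
    and "\<And>c k. k \<in> I \<Longrightarrow> \<bar>c k\<bar> \<le> B * norm (\<Sum>j\<in>I. c j *\<^sub>R v j)"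
proof -
  have inj: "inj_on v I" and ind: "independent (v ` I)"
    using assms(1) by (auto simp: lin_indep_family_def)
  have "\<exists>B>0. \<forall>c. \<bar>c k\<bar> \<le> B * norm (\<Sum>j\<in>I. c j *\<^sub>R v j)" if k: "k \<in> I" for k
  proof -
    obtain \<phi> :: "'a \<Rightarrow> real" where lin: "linear \<phi>"
      and \<phi>: "\<forall>x\<in>v ` I. \<phi> x = (if x = v k then 1 else 0)"
      using linear_independent_extend[OF ind, of "\<lambda>x. if x = v k then 1 else 0"] by blast
    obtain B where B: "B > 0" "\<And>x. norm (\<phi> x) \<le> B * norm x"
      using linear_bounded_pos[OF lin] by blast
    have "\<phi> (\<Sum>j\<in>I. c j *\<^sub>R v j) = c k" for c
    proof -
      have "\<phi> (\<Sum>j\<in>I. c j *\<^sub>R v j) = (\<Sum>j\<in>I. c j * \<phi> (v j))"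
        by (simp add: linear_sum[OF lin] linear_scale[OF lin])
      also have "\<dots> = (\<Sum>j\<in>I. if j = k then c j else 0)"
        using \<phi> inj k by (intro sum.cong) (auto simp: inj_on_eq_iff)
      finally show ?thesis
        using k assms(2) by simp
    qed
    then show ?thesis
      using B by (metis real_norm_def)
  qed
  then obtain B where B: "\<And>k. k \<in> I \<Longrightarrow> B k > 0"
      "\<And>k c. k \<in> I \<Longrightarrow> \<bar>c k\<bar> \<le> B k * norm (\<Sum>j\<in>I. c j *\<^sub>R v j)"
    by metis
  show thesis
  proof (rule that)
    show "1 + sum B I > 0"
      using B(1) by (intro add_pos_nonneg sum_nonneg) (auto intro: less_imp_le)
    fix c k assume k: "k \<in> I"
    have "B k \<le> 1 + sum B I"
      using member_le_sum[OF k, of B] B(1) assms(2) by (force intro: less_imp_le)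
    then show "\<bar>c k\<bar> \<le> (1 + sum B I) * norm (\<Sum>j\<in>I. c j *\<^sub>R v j)"
      using B(2)[OF k, of c] by (meson mult_right_mono norm_ge_zero order_trans)
  qed
qed

section \<open>Exponential decay from a degenerate dissipation\<close>

lemma halfline_nonincreasing:
  fixes V :: "real \<Rightarrow> real"
  assumes V: "\<And>t. t \<ge> 0 \<Longrightarrow> (V has_real_derivative V' t) (at t within {0..})"
    and V': "\<And>t. t \<ge> 0 \<Longrightarrow> V' t \<le> 0" and "t \<ge> 0"
  shows "V t \<le> V 0"
proof (rule DERIV_nonpos_imp_decreasing_open[OF \<open>t \<ge> 0\<close>])
  fix s assume s: "0 < s" "s < t"
  then have "at s within {0..} = at s"
    by (intro at_within_interior) simp
  then show "\<exists>y. (V has_real_derivative y) (at s) \<and> y \<le> 0"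
    using V[of s] V'[of s] s by auto
next
  have "continuous_on {0..} V"
    using V by (intro DERIV_continuous_on) auto
  then show "continuous_on {0..t} V"
    by (rule continuous_on_subset) auto
qed

lemma gronwall_decay:
  fixes V :: "real \<Rightarrow> real"
  assumes V: "\<And>t. t \<ge> 0 \<Longrightarrow> (V has_real_derivative V' t) (at t within {0..})"
    and V': "\<And>t. t \<ge> 0 \<Longrightarrow> V' t \<le> - \<beta> * V t" and "t \<ge> 0"
  shows "V t \<le> exp (- \<beta> * t) * V 0"
proof -
  have "exp (\<beta> * t) * V t \<le> exp (\<beta> * 0) * V 0"
  proof (rule halfline_nonincreasing[where V' = "\<lambda>t. exp (\<beta> * t) * (\<beta> * V t + V' t)"])
    fix s :: real assume s: "s \<ge> 0"
    show "((\<lambda>t. exp (\<beta> * t) * V t) has_real_derivative exp (\<beta> * s) * (\<beta> * V s + V' s))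
        (at s within {0..})"
      using V[OF s] by (auto intro!: derivative_eq_intros simp: algebra_simps)
    show "exp (\<beta> * s) * (\<beta> * V s + V' s) \<le> 0"
      using V'[OF s] by (simp add: mult_le_0_iff)
  qed fact
  then show ?thesis
    by (simp add: exp_minus field_simps)
qed

lemma has_real_derivative_inner:
  fixes u v :: "real \<Rightarrow> 'a :: real_inner"
  assumes "(u has_vector_derivative u') (at t within S)"
    and "(v has_vector_derivative v') (at t within S)"
  shows "((\<lambda>s. u s \<bullet> v s) has_real_derivative u' \<bullet> v t + u t \<bullet> v') (at t within S)"
  using bounded_bilinear.has_vector_derivative[OF bounded_bilinear_inner assms]
  by (simp add: has_real_derivative_iff_has_vector_derivative add.commute)

text \<open>
  The weight is small enough for two purposes: with \<open>\<bar>y \<bullet> P\<bar> \<le> K N\<close> the cross term changes \<open>N\<close>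
  by at most a half, and the error \<open>(C\<^sup>2 / 2 + C) D\<^sup>2\<close> in its derivative uses up at most half of
  the dissipation \<open>m D\<^sup>2\<close>.
\<close>

definition cross_weight :: "real \<Rightarrow> real \<Rightarrow> real \<Rightarrow> real" where
  "cross_weight m C K = min (1 / (2 * K)) (m / (2 * (C\<^sup>2 / 2 + C)))"

definition decay_rate :: "real \<Rightarrow> real \<Rightarrow> real \<Rightarrow> real" where
  "decay_rate m C K = min m (cross_weight m C K) / (3 * K)"

lemma cross_weight_pos: "\<lbrakk>m > 0; C > 0; K > 0\<rbrakk> \<Longrightarrow> cross_weight m C K > 0"
  by (simp add: cross_weight_def add_nonneg_pos)

lemma decay_rate_pos: "\<lbrakk>m > 0; C > 0; K > 0\<rbrakk> \<Longrightarrow> decay_rate m C K > 0"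
  by (simp add: decay_rate_def cross_weight_pos)

text \<open>
  The dissipation \<open>m D\<^sup>2\<close> may vanish at a state where \<open>P\<close> does not. But then the velocity \<open>X\<close> of
  \<open>y\<close> is \<open>- P\<close>, so the derivative of \<open>y \<bullet> P\<close> supplies the missing term \<open>- |P|\<^sup>2\<close>. Adding a small
  multiple of \<open>y \<bullet> P\<close> to \<open>N\<close> gives a function to which Gronwall's inequality applies.
\<close>

lemma decay_by_cross_term:
  fixes y P X Q :: "real \<Rightarrow> 'a :: real_inner" and N N' D :: "real \<Rightarrow> real"
  assumes m: "m > 0" and C: "C > 0" and K: "K > 0"
    and y: "\<And>t. t \<ge> 0 \<Longrightarrow> (y has_vector_derivative X t) (at t within {0..})"
    and P: "\<And>t. t \<ge> 0 \<Longrightarrow> (P has_vector_derivative Q t) (at t within {0..})"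
    and N: "\<And>t. t \<ge> 0 \<Longrightarrow> (N has_real_derivative N' t) (at t within {0..})"
    and N': "\<And>t. t \<ge> 0 \<Longrightarrow> N' t \<le> - m * (D t)\<^sup>2"
    and yD: "\<And>t. t \<ge> 0 \<Longrightarrow> norm (y t) \<le> D t"
    and XP: "\<And>t. t \<ge> 0 \<Longrightarrow> norm (X t + P t) \<le> C * D t"
    and Q: "\<And>t. t \<ge> 0 \<Longrightarrow> norm (Q t) \<le> C * D t"
    and NK: "\<And>t. t \<ge> 0 \<Longrightarrow> N t \<le> K * ((D t)\<^sup>2 + (norm (P t))\<^sup>2)"
    and yP: "\<And>t. t \<ge> 0 \<Longrightarrow> norm (y t) * norm (P t) \<le> K * N t"
    and t: "t \<ge> 0"
  shows "N t \<le> 3 * exp (- decay_rate m C K * t) * N 0"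
proof -
  define \<epsilon> where "\<epsilon> = cross_weight m C K"
  define \<delta> where "\<delta> = min m \<epsilon> / 2"
  define \<beta> where "\<beta> = decay_rate m C K"
  have CC: "C\<^sup>2 / 2 + C > 0"
    using C by (simp add: add_nonneg_pos)
  have \<epsilon>: "\<epsilon> > 0" and \<beta>: "\<beta> > 0"
    using m C K by (simp_all add: \<epsilon>_def \<beta>_def cross_weight_pos decay_rate_pos)
  have \<epsilon>K: "\<epsilon> * K \<le> 1 / 2"
  proof -
    have "\<epsilon> * K \<le> 1 / (2 * K) * K"
      using K by (intro mult_right_mono) (auto simp: \<epsilon>_def cross_weight_def)
    then show ?thesis using K by simp
  qed
  have \<epsilon>C: "\<epsilon> * (C\<^sup>2 / 2 + C) \<le> m / 2"
  proof -
    have "\<epsilon> * (C\<^sup>2 / 2 + C) \<le> m / (2 * (C\<^sup>2 / 2 + C)) * (C\<^sup>2 / 2 + C)"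
      using CC by (intro mult_right_mono) (auto simp: \<epsilon>_def cross_weight_def)
    also have "\<dots> = m / 2"
      using CC by (simp add: divide_simps)
    finally show ?thesis .
  qed
  have \<delta>: "\<delta> > 0" "\<delta> \<le> m / 2" "\<delta> \<le> \<epsilon> / 2"
    using m \<epsilon> by (auto simp: \<delta>_def)
  have \<beta>_eq: "\<beta> = 2 * \<delta> / (3 * K)"
    by (simp add: \<beta>_def decay_rate_def \<delta>_def \<epsilon>_def)
  define W where "W = (\<lambda>t. N t + \<epsilon> * (y t \<bullet> P t))"
  \<comment> \<open>The weight is so small that \<open>W\<close> stays comparable to \<open>N\<close>.\<close>
  have W_bounds: "N s / 2 \<le> W s" "W s \<le> 3 / 2 * N s" "0 \<le> N s" if s: "s \<ge> 0" for s
  proof -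
    have "0 \<le> norm (y s) * norm (P s)" by simp
    with yP[OF s] have "0 \<le> K * N s" by linarith
    with K show N0: "0 \<le> N s" by (simp add: zero_le_mult_iff)
    have "\<bar>\<epsilon> * (y s \<bullet> P s)\<bar> \<le> \<epsilon> * (K * N s)"
      using Cauchy_Schwarz_ineq2[of "y s" "P s"] yP[OF s] \<epsilon> by (simp add: abs_mult)
    also have "\<dots> \<le> 1 / 2 * N s"
      using mult_right_mono[OF \<epsilon>K N0] by (simp add: mult.assoc)
    finally show "N s / 2 \<le> W s" "W s \<le> 3 / 2 * N s"
      by (auto simp: W_def abs_le_iff)
  qed
  have "W t \<le> exp (- \<beta> * t) * W 0"
  proof (rule gronwall_decay[where V' = "\<lambda>s. N' s + \<epsilon> * (X s \<bullet> P s + y s \<bullet> Q s)"])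
    fix s :: real assume s: "s \<ge> 0"
    show "(W has_real_derivative N' s + \<epsilon> * (X s \<bullet> P s + y s \<bullet> Q s)) (at s within {0..})"
      unfolding W_def
      by (intro DERIV_add DERIV_cmult N has_real_derivative_inner y P s)
    let ?p = "norm (P s)"
    \<comment> \<open>The gain \<open>- |P|\<^sup>2\<close>; half of it absorbs the error of \<open>X \<approx> - P\<close>.\<close>
    have "X s \<bullet> P s = (X s + P s) \<bullet> P s - ?p\<^sup>2"
      by (simp add: inner_add_left power2_norm_eq_inner)
    also have "(X s + P s) \<bullet> P s \<le> norm (X s + P s) * ?p"
      by (rule norm_cauchy_schwarz)
    also have "\<dots> \<le> C * D s * ?p"
      using XP[OF s] by (intro mult_right_mono) auto
    also have "\<dots> \<le> (C * D s)\<^sup>2 / 2 + ?p\<^sup>2 / 2"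
      using sum_squares_bound[of "C * D s" ?p] by simp
    finally have 1: "X s \<bullet> P s \<le> C\<^sup>2 / 2 * (D s)\<^sup>2 - ?p\<^sup>2 / 2"
      by (simp add: power_mult_distrib)
    have "y s \<bullet> Q s \<le> norm (y s) * norm (Q s)"
      by (rule norm_cauchy_schwarz)
    also have "\<dots> \<le> D s * (C * D s)"
      using yD[OF s] Q[OF s] order_trans[OF norm_ge_zero yD[OF s]] by (intro mult_mono) auto
    finally have 2: "y s \<bullet> Q s \<le> C * (D s)\<^sup>2"
      by (simp add: power2_eq_square mult_ac)
    have "N' s + \<epsilon> * (X s \<bullet> P s + y s \<bullet> Q s)
        \<le> - m * (D s)\<^sup>2 + \<epsilon> * ((C\<^sup>2 / 2 * (D s)\<^sup>2 - ?p\<^sup>2 / 2) + C * (D s)\<^sup>2)"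
      using N'[OF s] 1 2 \<epsilon> by (intro add_mono mult_left_mono) auto
    also have "\<dots> = - m * (D s)\<^sup>2 + (\<epsilon> * (C\<^sup>2 / 2 + C)) * (D s)\<^sup>2 - \<epsilon> / 2 * ?p\<^sup>2"
      by (simp add: algebra_simps)
    also have "\<dots> \<le> - (m / 2) * (D s)\<^sup>2 - \<epsilon> / 2 * ?p\<^sup>2"
      using mult_right_mono[OF \<epsilon>C, of "(D s)\<^sup>2"] by simp
    also have "\<dots> \<le> - \<delta> * (D s)\<^sup>2 - \<delta> * ?p\<^sup>2"
      using mult_right_mono[OF \<delta>(2), of "(D s)\<^sup>2"] mult_right_mono[OF \<delta>(3), of "?p\<^sup>2"]
      by simp
    also have "\<dots> \<le> - (\<delta> / K) * N s"
      using mult_left_mono[OF NK[OF s], of "\<delta> / K"] \<delta> K by (simp add: algebra_simps)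
    also have "\<dots> \<le> - \<beta> * W s"
      using mult_left_mono[OF W_bounds(2)[OF s], of \<beta>] \<beta> K by (simp add: \<beta>_eq)
    finally show "N' s + \<epsilon> * (X s \<bullet> P s + y s \<bullet> Q s) \<le> - \<beta> * W s" .
  qed fact
  also have "\<dots> \<le> exp (- \<beta> * t) * (3 / 2 * N 0)"
    using W_bounds(2)[of 0] by simp
  finally show ?thesis
    using W_bounds(1)[OF t] by (simp add: \<beta>_def)
qed

section \<open>The dynamics around a KKT point\<close>

text \<open>
  The KKT conditions carry the optimality of \<open>x*\<close>. The bound and the Lipschitz constant of the
  constraint gradients are those of one ball at a time, because a trajectory does not leave the
  closed ball around the KKT point on whose boundary it starts.
\<close>

locale regular_kkt_point =
  fixes f :: "real ^ 'n \<Rightarrow> real" and Df :: "real ^ 'n \<Rightarrow> real ^ 'n"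
    and g :: "nat \<Rightarrow> real ^ 'n \<Rightarrow> real" and Dg :: "nat \<Rightarrow> real ^ 'n \<Rightarrow> real ^ 'n"
    and A :: "nat \<Rightarrow> real ^ 'n" and b :: "nat \<Rightarrow> real"
    and mI mE :: nat and \<rho> \<mu> l :: real
    and xs :: "real ^ 'n" and lams nus :: "nat \<Rightarrow> real"
  assumes rho_pos: "\<rho> > 0"
    and f_gradient: "\<And>x. GDERIV f x :> Df x"
    and g_gradient: "\<And>i x. i \<in> {1..mI} \<Longrightarrow> GDERIV (g i) x :> Dg i x"
    and g_convex: "\<And>i. i \<in> {1..mI} \<Longrightarrow> convex_on UNIV (g i)"
    and mu_pos: "\<mu> > 0"
    and f_strongly_convex: "strongly_convex \<mu> f"
    and licq: "LICQ mI g Dg mE A xs"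
    and kkt: "KKT Df mI g Dg mE A b (xs, lams, nus)"
    and Df_lipschitz: "l-lipschitz_on UNIV Df"
    and Dg_locally_lipschitz: "\<And>i h. i \<in> {1..mI} \<Longrightarrow> h \<ge> 0 \<Longrightarrow>
          \<exists>L M. 0 \<le> L \<and> (\<forall>x\<in>cball xs h. norm (Dg i x) \<le> L) \<and> M-lipschitz_on (cball xs h) (Dg i)"
begin

declare pd_dist.simps [simp del]

abbreviation active :: "nat set" where "active \<equiv> active_set mI g xs"

text \<open>The \<open>\<rho>\<close>-fold velocity of \<open>\<lambda>\<^sub>i\<close>.\<close>

definition gap :: "real ^ 'n \<Rightarrow> (nat \<Rightarrow> real) \<Rightarrow> nat \<Rightarrow> real" where
  "gap x lam i = max (\<rho> * g i x + lam i) 0 - lam i"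

text \<open>The part of the error that the derivative of the squared distance controls.\<close>

definition defect :: "real ^ 'n \<Rightarrow> (nat \<Rightarrow> real) \<Rightarrow> real" where
  "defect x lam = sqrt ((norm (x - xs))\<^sup>2 + (\<Sum>i\<in>{1..mI}. (gap x lam i)\<^sup>2))"

text \<open>The force that the errors of \<open>\<nu>\<close> and of the active \<open>\<lambda>\<^sub>i\<close> exert on \<open>x\<close>, up to sign. The
  gradients are evaluated at \<open>x*\<close>, not at \<open>x\<close>, so that LICQ applies to their combination.\<close>

definition force :: "(nat \<Rightarrow> real) \<Rightarrow> (nat \<Rightarrow> real) \<Rightarrow> real ^ 'n" where
  "force lam nu = (\<Sum>i\<in>active. (lam i - lams i) *\<^sub>R Dg i xs) + (\<Sum>j\<in>{1..mE}. (nu j - nus j) *\<^sub>R A j)"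

abbreviation dist_kkt :: "real ^ 'n \<Rightarrow> (nat \<Rightarrow> real) \<Rightarrow> (nat \<Rightarrow> real) \<Rightarrow> real" where
  "dist_kkt x lam nu \<equiv> pd_dist mI mE (x, lam, nu) (xs, lams, nus)"

lemma active_subset: "active \<subseteq> {1..mI}"
  by (auto simp: active_set_def)

lemma finite_active: "finite active"
  using active_subset finite_subset by blast

lemma pdgd_lambda_eq_gap: "pdgd_lambda \<rho> g (x, lam, nu) i = gap x lam i / \<rho>"
  by (simp add: gap_def)

lemma stationary:
  "Df xs + (\<Sum>j\<in>{1..mE}. nus j *\<^sub>R A j) + (\<Sum>i\<in>{1..mI}. lams i *\<^sub>R Dg i xs) = 0"
  using kkt by simp

lemma A_xs: "j \<in> {1..mE} \<Longrightarrow> A j \<bullet> xs = b j"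
  using kkt by (simp add: feasible_set_def)

text \<open>Complementary slackness as a fixed point equation, which makes the KKT point an equilibrium.\<close>

lemma lams_projection: "i \<in> {1..mI} \<Longrightarrow> max (\<rho> * g i xs + lams i) 0 = lams i"
proof -
  assume i: "i \<in> {1..mI}"
  then have "g i xs \<le> 0" "0 \<le> lams i" "lams i * g i xs = 0"
    using kkt by (auto simp: feasible_set_def)
  then show ?thesis
    using rho_pos by (auto simp: max_def mult_le_0_iff)
qed

lemma inactive:
  assumes "i \<in> {1..mI} - active"
  shows "g i xs < 0" and "lams i = 0"
  using assms kkt by (force simp: feasible_set_def active_set_def)+

lemma equilibrium: "pdgd_equilibrium \<rho> Df mI g Dg mE A b (xs, lams, nus)"
  using stationary A_xs lams_projection by (simp add: pdgd_equilibrium_def algebra_simps add_eq_0_iff)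

lemma Df_strongly_monotone: "\<mu> * (norm (x - xs))\<^sup>2 \<le> (Df x - Df xs) \<bullet> (x - xs)"
  using gradient_lower_bound[OF f_strongly_convex f_gradient, of xs x]
    gradient_lower_bound[OF f_strongly_convex f_gradient, of x xs]
  by (simp add: norm_minus_commute inner_diff_left inner_diff_right)

lemma g_tangent: "i \<in> {1..mI} \<Longrightarrow> g i x + Dg i x \<bullet> (y - x) \<le> g i y"
  using gradient_lower_bound[OF convex_on_imp_strongly_convex_0[OF g_convex] g_gradient] by simp

lemma dist_kkt_sq:
  "(dist_kkt x lam nu)\<^sup>2 = (norm (x - xs))\<^sup>2 + (\<Sum>i\<in>{1..mI}. (lam i - lams i)\<^sup>2)
      + (\<Sum>j\<in>{1..mE}. (nu j - nus j)\<^sup>2)"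
  by (simp add: pd_dist.simps sum_nonneg)

lemma dist_kkt_bounds:
  "norm (x - xs) \<le> dist_kkt x lam nu"
  "i \<in> {1..mI} \<Longrightarrow> \<bar>lam i - lams i\<bar> \<le> dist_kkt x lam nu"
  "j \<in> {1..mE} \<Longrightarrow> \<bar>nu j - nus j\<bar> \<le> dist_kkt x lam nu"
proof -
  have nn: "0 \<le> (\<Sum>i\<in>{1..mI}. (lam i - lams i)\<^sup>2)" "0 \<le> (\<Sum>j\<in>{1..mE}. (nu j - nus j)\<^sup>2)"
    "0 \<le> (norm (x - xs))\<^sup>2"
    by (simp_all add: sum_nonneg)
  show "norm (x - xs) \<le> dist_kkt x lam nu"
    unfolding pd_dist.simps by (rule real_le_rsqrt) (use nn in linarith)
  show "\<bar>lam i - lams i\<bar> \<le> dist_kkt x lam nu" if "i \<in> {1..mI}"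
    unfolding pd_dist.simps
    using nn member_le_sum[OF that, of "\<lambda>i. (lam i - lams i)\<^sup>2"]
    by (intro real_le_rsqrt) (simp add: add_increasing add_increasing2)
  show "\<bar>nu j - nus j\<bar> \<le> dist_kkt x lam nu" if "j \<in> {1..mE}"
    unfolding pd_dist.simps
    using nn member_le_sum[OF that, of "\<lambda>j. (nu j - nus j)\<^sup>2"]
    by (intro real_le_rsqrt) (simp add: add_increasing)
qed

lemma defect_sq: "(defect x lam)\<^sup>2 = (norm (x - xs))\<^sup>2 + (\<Sum>i\<in>{1..mI}. (gap x lam i)\<^sup>2)"
  by (simp add: defect_def sum_nonneg)

lemma defect_bounds:
  "0 \<le> defect x lam"
  "norm (x - xs) \<le> defect x lam"
  "i \<in> {1..mI} \<Longrightarrow> \<bar>gap x lam i\<bar> \<le> defect x lam"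
proof -
  have nn: "0 \<le> (\<Sum>i\<in>{1..mI}. (gap x lam i)\<^sup>2)"  "0 \<le> (norm (x - xs))\<^sup>2"
    by (simp_all add: sum_nonneg)
  show "0 \<le> defect x lam"
    using nn by (simp add: defect_def)
  show "norm (x - xs) \<le> defect x lam"
    unfolding defect_def by (rule real_le_rsqrt) (use nn in linarith)
  show "\<bar>gap x lam i\<bar> \<le> defect x lam" if "i \<in> {1..mI}"
    unfolding defect_def
    using nn member_le_sum[OF that, of "\<lambda>i. (gap x lam i)\<^sup>2"]
    by (intro real_le_rsqrt) (simp add: add_increasing)
qed

text \<open>
  Write \<open>u = \<rho> g\<^sub>i(x) + \<lambda>\<^sub>i\<close> and \<open>w = [u]\<^sub>+\<close>, so that the values at the KKT point are
  \<open>u*\<close> and \<open>w* = \<lambda>\<^sub>i*\<close>. The tangent inequalities at \<open>x\<close> and at \<open>x*\<close>, weighted by the nonnegative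
  numbers \<open>w\<close> and \<open>w*\<close>, remove the gradients. What remains is \<open>1/\<rho>\<close> times
  \<open>- (w - w*)(u - u*) + 2 (w - w*)(\<lambda>\<^sub>i - \<lambda>\<^sub>i*) - (\<lambda>\<^sub>i - \<lambda>\<^sub>i*)\<^sup>2\<close>, and replacing the first product by
  \<open>(w - w*)\<^sup>2\<close> completes the square \<open>- (w - \<lambda>\<^sub>i)\<^sup>2\<close>.
\<close>

lemma multiplier_dissipation:
  assumes i: "i \<in> {1..mI}"
  shows "- ((max (\<rho> * g i x + lam i) 0 *\<^sub>R Dg i x - lams i *\<^sub>R Dg i xs) \<bullet> (x - xs))
      + (lam i - lams i) * (gap x lam i / \<rho>) \<le> - ((gap x lam i)\<^sup>2 / \<rho>)"
proof -
  define u where "u = \<rho> * g i x + lam i"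
  define us where "us = \<rho> * g i xs + lams i"
  define w where "w = max u 0"
  have ws: "max us 0 = lams i"
    using lams_projection[OF i] by (simp add: us_def)
  have w0: "0 \<le> w" and l0: "0 \<le> lams i"
    using ws by (auto simp: w_def)
  have "w * (g i x - g i xs) \<le> w * (Dg i x \<bullet> (x - xs))"
    using g_tangent[OF i, of x xs] w0 by (intro mult_left_mono) (auto simp: inner_diff_right)
  moreover have "lams i * (Dg i xs \<bullet> (x - xs)) \<le> lams i * (g i x - g i xs)"
    using g_tangent[OF i, of xs x] l0 by (intro mult_left_mono) auto
  ultimately have "- ((w *\<^sub>R Dg i x - lams i *\<^sub>R Dg i xs) \<bullet> (x - xs))
      \<le> - ((w - lams i) * (g i x - g i xs))"
    by (simp add: inner_diff_left algebra_simps)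
  also have "\<dots> = - ((w - lams i) * ((u - us) - (lam i - lams i)) / \<rho>)"
    using rho_pos by (simp add: u_def us_def field_simps)
  finally have "- ((w *\<^sub>R Dg i x - lams i *\<^sub>R Dg i xs) \<bullet> (x - xs)) + (lam i - lams i) * ((w - lam i) / \<rho>)
      \<le> (- ((w - lams i) * ((u - us) - (lam i - lams i))) + (lam i - lams i) * (w - lam i)) / \<rho>"
    by (simp only: add_divide_distrib minus_divide_left times_divide_eq_right add_right_mono)
  also have "\<dots> \<le> - (w - lam i)\<^sup>2 / \<rho>"
  proof (rule divide_right_mono)
    have "(w - lams i)\<^sup>2 \<le> (w - lams i) * (u - us)"
      using positive_part_firmly_nonexpansive[of u us] unfolding ws w_def .
    then show "- ((w - lams i) * ((u - us) - (lam i - lams i))) + (lam i - lams i) * (w - lam i)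
        \<le> - (w - lam i)\<^sup>2"
      by (simp add: power2_eq_square algebra_simps)
  qed (use rho_pos in simp)
  finally show ?thesis
    by (simp add: w_def u_def gap_def)
qed

text \<open>The right-hand side in terms of deviations from the KKT point, by subtracting stationarity.\<close>

lemma pdgd_x_eq:
  "pdgd_x \<rho> Df mI g Dg mE A (x, lam, nu) =
     - (Df x - Df xs) - (\<Sum>j\<in>{1..mE}. (nu j - nus j) *\<^sub>R A j)
     - (\<Sum>i\<in>{1..mI}. max (\<rho> * g i x + lam i) 0 *\<^sub>R Dg i x - lams i *\<^sub>R Dg i xs)"
  using stationary by (simp add: sum_subtractf scaleR_diff_left algebra_simps add_eq_0_iff2)

text \<open>The left-hand side is half the derivative of the squared distance along the dynamics. The terms
  with \<open>A\<close> of the first and the third summand cancel.\<close>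

lemma dissipation:
  "pdgd_x \<rho> Df mI g Dg mE A (x, lam, nu) \<bullet> (x - xs)
     + (\<Sum>i\<in>{1..mI}. (lam i - lams i) * pdgd_lambda \<rho> g (x, lam, nu) i)
     + (\<Sum>j\<in>{1..mE}. (nu j - nus j) * pdgd_nu A b (x, lam, nu) j)
   \<le> - min \<mu> (1 / \<rho>) * (defect x lam)\<^sup>2"
proof -
  let ?v = "\<lambda>i. max (\<rho> * g i x + lam i) 0 *\<^sub>R Dg i x - lams i *\<^sub>R Dg i xs"
  have nu: "pdgd_nu A b (x, lam, nu) j = A j \<bullet> (x - xs)" if "j \<in> {1..mE}" for j
    using A_xs[OF that] by (simp add: inner_diff_right)
  have "pdgd_x \<rho> Df mI g Dg mE A (x, lam, nu) \<bullet> (x - xs)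
     + (\<Sum>i\<in>{1..mI}. (lam i - lams i) * pdgd_lambda \<rho> g (x, lam, nu) i)
     + (\<Sum>j\<in>{1..mE}. (nu j - nus j) * pdgd_nu A b (x, lam, nu) j)
   = - ((Df x - Df xs) \<bullet> (x - xs))
     + (\<Sum>i\<in>{1..mI}. - (?v i \<bullet> (x - xs)) + (lam i - lams i) * (gap x lam i / \<rho>))"
    by (simp only: pdgd_x_eq pdgd_lambda_eq_gap nu inner_diff_left[of _ _ "x - xs"] inner_minus_left
        inner_sum_left inner_scaleR_left sum.distrib sum_negf cong: sum.cong)
  also have "\<dots> \<le> - (\<mu> * (norm (x - xs))\<^sup>2) + (\<Sum>i\<in>{1..mI}. - ((gap x lam i)\<^sup>2 / \<rho>))"
    using Df_strongly_monotone[of x] multiplier_dissipation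
    by (intro add_mono sum_mono) auto
  also have "\<dots> = - (\<mu> * (norm (x - xs))\<^sup>2) - 1 / \<rho> * (\<Sum>i\<in>{1..mI}. (gap x lam i)\<^sup>2)"
    by (simp add: sum_negf sum_divide_distrib)
  also have "\<dots> \<le> - min \<mu> (1 / \<rho>) * (norm (x - xs))\<^sup>2
      - min \<mu> (1 / \<rho>) * (\<Sum>i\<in>{1..mI}. (gap x lam i)\<^sup>2)"
    using mult_right_mono[of "min \<mu> (1 / \<rho>)" \<mu> "(norm (x - xs))\<^sup>2"]
      mult_right_mono[of "min \<mu> (1 / \<rho>)" "1 / \<rho>" "\<Sum>i\<in>{1..mI}. (gap x lam i)\<^sup>2"]
    by (simp add: sum_nonneg)
  finally show ?thesis
    by (simp add: defect_sq algebra_simps)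
qed

text \<open>By LICQ the force determines the multiplier errors that enter it. This recovers exactly the
  components that the dissipation does not see.\<close>

lemma multipliers_le_force:
  obtains B where "B > 0"
    and "\<And>lam nu. (\<Sum>i\<in>active. (lam i - lams i)\<^sup>2) + (\<Sum>j\<in>{1..mE}. (nu j - nus j)\<^sup>2)
          \<le> B * (norm (force lam nu))\<^sup>2"
proof -
  let ?I = "active <+> {1..mE}" and ?v = "case_sum (\<lambda>i. Dg i xs) A"
  have fin: "finite ?I"
    using finite_active by simp
  obtain B where B: "B > 0"
    "\<And>c k. k \<in> ?I \<Longrightarrow> \<bar>c k\<bar> \<le> B * norm (\<Sum>j\<in>?I. c j *\<^sub>R ?v j)"
    by (rule lin_indep_family_coeff_bound[OF licq[unfolded LICQ_def] fin]) (rule that)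
  show thesis
  proof (rule that)
    show "(1 + real (card ?I)) * B\<^sup>2 > 0"
      using B(1) by (simp add: add_pos_nonneg)
    fix lam nu :: "nat \<Rightarrow> real"
    let ?c = "case_sum (\<lambda>i. lam i - lams i) (\<lambda>j. nu j - nus j)"
    have "(\<Sum>j\<in>?I. ?c j *\<^sub>R ?v j) = force lam nu"
      using finite_active by (simp add: sum.Plus force_def)
    then have "(?c k)\<^sup>2 \<le> (B * norm (force lam nu))\<^sup>2" if "k \<in> ?I" for k
      using B(2)[OF that, of ?c] by (intro abs_le_square_iff[THEN iffD1]) simp
    then have "(\<Sum>k\<in>?I. (?c k)\<^sup>2) \<le> real (card ?I) * (B * norm (force lam nu))\<^sup>2"
      by (rule sum_bounded_above)
    also have "\<dots> \<le> (1 + real (card ?I)) * B\<^sup>2 * (norm (force lam nu))\<^sup>2"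
      by (simp add: power_mult_distrib algebra_simps)
    finally show "(\<Sum>i\<in>active. (lam i - lams i)\<^sup>2) + (\<Sum>j\<in>{1..mE}. (nu j - nus j)\<^sup>2)
        \<le> (1 + real (card ?I)) * B\<^sup>2 * (norm (force lam nu))\<^sup>2"
      using finite_active by (simp add: sum.Plus)
  qed
qed

text \<open>Both one-sided bounds are tangent inequalities, one with the gradient at \<open>x\<close> and one with the
  gradient at \<open>x*\<close>.\<close>

lemma g_bound:
  assumes i: "i \<in> {1..mI}" and L: "\<And>x. x \<in> cball xs h \<Longrightarrow> norm (Dg i x) \<le> L"
    and x: "norm (x - xs) \<le> h"
  shows "\<bar>g i x - g i xs\<bar> \<le> L * norm (x - xs)"
proof -
  have xin: "x \<in> cball xs h" "xs \<in> cball xs h"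
    using x order_trans[OF norm_ge_zero x] by (auto simp: dist_norm norm_minus_commute)
  have *: "\<bar>Dg i z \<bullet> (x - xs)\<bar> \<le> L * norm (x - xs)" if "z \<in> cball xs h" for z
    using Cauchy_Schwarz_ineq2[of "Dg i z" "x - xs"] mult_right_mono[OF L[OF that], of "norm (x - xs)"]
    by simp
  show ?thesis
    using g_tangent[OF i, of x xs] g_tangent[OF i, of xs x] *[OF xin(1)] *[OF xin(2)]
    by (simp add: inner_diff_right abs_le_iff)
qed

text \<open>
  If the projection truncates, the gap is \<open>- \<lambda>\<^sub>i\<close> itself. Otherwise the gap is \<open>\<rho> g\<^sub>i(x)\<close>, and
  since \<open>g\<^sub>i(x*) < 0\<close>, either this is not small or \<open>x\<close> is far from \<open>x*\<close>. So the defect is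
  bounded below, and a multiple of it dominates the a priori bound \<open>h\<close> on \<open>\<lambda>\<^sub>i\<close>. The resulting
  constant depends on \<open>h\<close>, and so does the decay rate.
\<close>

lemma inactive_multiplier_bound:
  assumes i: "i \<in> {1..mI} - active" and "h > 0"
  obtains B where "B \<ge> 0"
    and "\<And>x lam nu. dist_kkt x lam nu \<le> h \<Longrightarrow> \<bar>lam i - lams i\<bar> \<le> B * defect x lam"
proof -
  have iI: "i \<in> {1..mI}"
    using i by simp
  obtain L where L: "0 \<le> L" "\<And>x. x \<in> cball xs h \<Longrightarrow> norm (Dg i x) \<le> L"
    using Dg_locally_lipschitz[OF iI, of h] \<open>h > 0\<close> by auto
  define B where "B = h * (1 / \<rho> + L) / \<bar>g i xs\<bar>"
  have B0: "B \<ge> 0"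
    using \<open>h > 0\<close> L rho_pos by (simp add: B_def)
  show thesis
  proof (rule that)
    show "1 + B \<ge> 0" using B0 by simp
    fix x lam nu assume h: "dist_kkt x lam nu \<le> h"
    have lh: "\<bar>lam i - lams i\<bar> \<le> h" and xh: "norm (x - xs) \<le> h"
      using dist_kkt_bounds(2)[OF iI, of lam x nu] dist_kkt_bounds(1)[of x lam nu] h by linarith+
    have BD: "0 \<le> B * defect x lam"
      using B0 defect_bounds(1) by simp
    show "\<bar>lam i - lams i\<bar> \<le> (1 + B) * defect x lam"
    proof (cases "\<rho> * g i x + lam i \<le> 0")
      case True
      then have "\<bar>lam i - lams i\<bar> = \<bar>gap x lam i\<bar>"
        using inactive(2)[OF i] by (simp add: gap_def max_def)
      then show ?thesis
        using defect_bounds(3)[OF iI, of x lam] BD by (simp add: algebra_simps)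
    next
      case False
      then have "g i x = gap x lam i / \<rho>"
        using rho_pos by (simp add: gap_def)
      then have "\<bar>g i xs\<bar> \<le> \<bar>gap x lam i\<bar> / \<rho> + L * norm (x - xs)"
        using g_bound[OF iI L(2) xh] rho_pos abs_triangle_ineq4[of "g i x" "g i x - g i xs"]
        by (simp add: abs_divide)
      also have "\<dots> \<le> defect x lam / \<rho> + L * defect x lam"
        using defect_bounds(2)[of x lam] defect_bounds(3)[OF iI, of x lam] rho_pos L(1)
        by (intro add_mono divide_right_mono mult_left_mono) auto
      finally have "h * \<bar>g i xs\<bar> \<le> h * (1 / \<rho> + L) * defect x lam"
        unfolding mult.assoc
        using \<open>h > 0\<close> by (intro mult_left_mono) (auto simp: algebra_simps)
      also have "h * (1 / \<rho> + L) = B * \<bar>g i xs\<bar>"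
        using inactive(1)[OF i] by (simp add: B_def)
      finally have "h * \<bar>g i xs\<bar> \<le> (B * defect x lam) * \<bar>g i xs\<bar>"
        by (simp only: mult_ac)
      then have "h \<le> B * defect x lam"
        using inactive(1)[OF i] by (auto simp only: mult_le_cancel_right zero_less_abs_iff)
      then show ?thesis
        using lh defect_bounds(1)[of x lam] by (simp add: algebra_simps)
    qed
  qed
qed

text \<open>After the force has been compensated, every remaining term carries a factor that the defect
  controls: a difference of gradients, a gap, or an inactive multiplier.\<close>

lemma pdgd_x_plus_force:
  "pdgd_x \<rho> Df mI g Dg mE A (x, lam, nu) + force lam nu =
     - (Df x - Df xs)
     - (\<Sum>i\<in>{1..mI}. max (\<rho> * g i x + lam i) 0 *\<^sub>R (Dg i x - Dg i xs) + gap x lam i *\<^sub>R Dg i xs)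
     - (\<Sum>i\<in>{1..mI} - active. (lam i - lams i) *\<^sub>R Dg i xs)"
proof -
  have "(\<Sum>i\<in>{1..mI}. max (\<rho> * g i x + lam i) 0 *\<^sub>R Dg i x - lams i *\<^sub>R Dg i xs)
      = (\<Sum>i\<in>{1..mI}. max (\<rho> * g i x + lam i) 0 *\<^sub>R (Dg i x - Dg i xs) + gap x lam i *\<^sub>R Dg i xs)
        + (\<Sum>i\<in>{1..mI}. (lam i - lams i) *\<^sub>R Dg i xs)"
    by (simp add: sum.distrib[symmetric] gap_def algebra_simps)
  moreover have "(\<Sum>i\<in>{1..mI}. (lam i - lams i) *\<^sub>R Dg i xs)
      = (\<Sum>i\<in>{1..mI} - active. (lam i - lams i) *\<^sub>R Dg i xs) + (\<Sum>i\<in>active. (lam i - lams i) *\<^sub>R Dg i xs)"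
    by (rule sum.subset_diff[OF active_subset]) simp
  ultimately show ?thesis
    unfolding pdgd_x_eq force_def by simp
qed

text \<open>The constants of the force estimate on the ball of radius \<open>h\<close>, one for each constraint.\<close>

lemma local_bounds:
  assumes h: "h > 0"
  obtains Ca Cw M where "\<And>i. i \<in> {1..mI} - active \<Longrightarrow> 0 \<le> Ca i"
    "\<And>i. i \<in> {1..mI} \<Longrightarrow> 0 \<le> Cw i"
    "\<And>i. i \<in> {1..mI} \<Longrightarrow> 0 \<le> M i"
    "\<And>x lam nu i. dist_kkt x lam nu \<le> h \<Longrightarrow> i \<in> {1..mI} - active \<Longrightarrow>
        \<bar>lam i - lams i\<bar> \<le> Ca i * defect x lam"
    "\<And>x lam nu i. dist_kkt x lam nu \<le> h \<Longrightarrow> i \<in> {1..mI} \<Longrightarrow> max (\<rho> * g i x + lam i) 0 \<le> Cw i"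
    "\<And>x lam nu i. dist_kkt x lam nu \<le> h \<Longrightarrow> i \<in> {1..mI} \<Longrightarrow>
        norm (Dg i x - Dg i xs) \<le> M i * norm (x - xs)"
proof -
  have "\<forall>i\<in>{1..mI} - active. \<exists>C\<ge>0. \<forall>x lam nu. dist_kkt x lam nu \<le> h \<longrightarrow>
      \<bar>lam i - lams i\<bar> \<le> C * defect x lam"
    using inactive_multiplier_bound[OF _ h] by metis
  then obtain Ca where Ca: "\<And>i. i \<in> {1..mI} - active \<Longrightarrow> 0 \<le> Ca i"
    "\<And>x lam nu i. dist_kkt x lam nu \<le> h \<Longrightarrow> i \<in> {1..mI} - active \<Longrightarrow>
        \<bar>lam i - lams i\<bar> \<le> Ca i * defect x lam"
    by metis
  have "\<forall>i\<in>{1..mI}. \<exists>L M. 0 \<le> L \<and> (\<forall>x\<in>cball xs h. norm (Dg i x) \<le> L) \<and>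
      M-lipschitz_on (cball xs h) (Dg i)"
    using Dg_locally_lipschitz h by simp
  then obtain L M where LM: "\<And>i. i \<in> {1..mI} \<Longrightarrow> 0 \<le> L i"
    "\<And>i x. i \<in> {1..mI} \<Longrightarrow> x \<in> cball xs h \<Longrightarrow> norm (Dg i x) \<le> L i"
    "\<And>i. i \<in> {1..mI} \<Longrightarrow> (M i)-lipschitz_on (cball xs h) (Dg i)"
    by metis
  define Cw where "Cw i = \<rho> * (\<bar>g i xs\<bar> + L i * h) + \<bar>lams i\<bar> + h" for i
  have Cw0: "0 \<le> Cw i" if "i \<in> {1..mI}" for i
    using LM(1)[OF that] rho_pos h by (simp add: Cw_def)
  show thesis
  proof (rule that[of Ca Cw M])
    show "0 \<le> M i" if "i \<in> {1..mI}" for i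
      using LM(3)[OF that] by (simp add: lipschitz_on_def)
    fix x lam nu i assume d: "dist_kkt x lam nu \<le> h" and i: "i \<in> {1..mI}"
    have lh: "\<bar>lam i - lams i\<bar> \<le> h" and xh: "norm (x - xs) \<le> h"
      using dist_kkt_bounds(2)[OF i, of lam x nu] dist_kkt_bounds(1)[of x lam nu] d by linarith+
    have "L i * norm (x - xs) \<le> L i * h"
      using xh LM(1)[OF i] by (rule mult_left_mono)
    then have "g i x \<le> \<bar>g i xs\<bar> + L i * h"
      using g_bound[OF i LM(2)[OF i] xh] by linarith
    then have "\<rho> * g i x \<le> \<rho> * (\<bar>g i xs\<bar> + L i * h)"
      using rho_pos by simp
    then have "\<rho> * g i x + lam i \<le> Cw i"
      unfolding Cw_def using lh by linarith
    then show "max (\<rho> * g i x + lam i) 0 \<le> Cw i"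
      using Cw0[OF i] by simp
    have "dist (Dg i x) (Dg i xs) \<le> M i * dist x xs"
      using xh h by (intro lipschitz_onD[OF LM(3)[OF i]]) (auto simp: dist_norm norm_minus_commute)
    then show "norm (Dg i x - Dg i xs) \<le> M i * norm (x - xs)"
      by (simp add: dist_norm)
  qed (use Ca Cw0 in auto)
qed

lemma pdgd_x_force_bound:
  assumes h: "h > 0"
  obtains C where "C > 0"
    and "\<And>x lam nu. dist_kkt x lam nu \<le> h \<Longrightarrow>
      norm (pdgd_x \<rho> Df mI g Dg mE A (x, lam, nu) + force lam nu) \<le> C * defect x lam"
proof -
  obtain Ca Cw M where nonneg: "\<And>i. i \<in> {1..mI} - active \<Longrightarrow> 0 \<le> Ca i"
    "\<And>i. i \<in> {1..mI} \<Longrightarrow> 0 \<le> Cw i" "\<And>i. i \<in> {1..mI} \<Longrightarrow> 0 \<le> M i"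
    and bnd: "\<And>x lam nu i. dist_kkt x lam nu \<le> h \<Longrightarrow> i \<in> {1..mI} - active \<Longrightarrow>
        \<bar>lam i - lams i\<bar> \<le> Ca i * defect x lam"
    "\<And>x lam nu i. dist_kkt x lam nu \<le> h \<Longrightarrow> i \<in> {1..mI} \<Longrightarrow> max (\<rho> * g i x + lam i) 0 \<le> Cw i"
    "\<And>x lam nu i. dist_kkt x lam nu \<le> h \<Longrightarrow> i \<in> {1..mI} \<Longrightarrow>
        norm (Dg i x - Dg i xs) \<le> M i * norm (x - xs)"
    by (rule local_bounds[OF h]) (rule that)
  define C where "C = 1 + l + (\<Sum>i\<in>{1..mI}. Cw i * M i + norm (Dg i xs))
      + (\<Sum>i\<in>{1..mI} - active. Ca i * norm (Dg i xs))"
  have l: "l \<ge> 0"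
    using Df_lipschitz by (simp add: lipschitz_on_def)
  have "0 < C"
    unfolding C_def using l nonneg
    by (intro add_pos_nonneg sum_nonneg add_nonneg_nonneg mult_nonneg_nonneg) auto
  then show thesis
  proof (rule that)
    fix x lam nu assume d: "dist_kkt x lam nu \<le> h"
    let ?D = "defect x lam" and ?w = "\<lambda>i. max (\<rho> * g i x + lam i) 0"
    have "norm (Df x - Df xs) \<le> l * norm (x - xs)"
      using lipschitz_onD[OF Df_lipschitz, of x xs] by (simp add: dist_norm)
    also have "\<dots> \<le> l * ?D"
      using l defect_bounds(2) by (intro mult_left_mono)
    finally have 1: "norm (Df x - Df xs) \<le> l * ?D" .
    have 2: "norm (\<Sum>i\<in>{1..mI}. ?w i *\<^sub>R (Dg i x - Dg i xs) + gap x lam i *\<^sub>R Dg i xs)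
        \<le> (\<Sum>i\<in>{1..mI}. (Cw i * M i + norm (Dg i xs)) * ?D)"
    proof (rule sum_norm_le)
      fix i assume i: "i \<in> {1..mI}"
      have "norm (Dg i x - Dg i xs) \<le> M i * ?D"
        using bnd(3)[OF d i] mult_left_mono[OF defect_bounds(2) nonneg(3)[OF i], of x lam] by simp
      then have "norm (?w i *\<^sub>R (Dg i x - Dg i xs)) \<le> Cw i * (M i * ?D)"
        using bnd(2)[OF d i] nonneg(2)[OF i] by (simp add: mult_mono)
      moreover have "norm (gap x lam i *\<^sub>R Dg i xs) \<le> ?D * norm (Dg i xs)"
        using defect_bounds(3)[OF i] by (simp add: mult_right_mono)
      ultimately show "norm (?w i *\<^sub>R (Dg i x - Dg i xs) + gap x lam i *\<^sub>R Dg i xs)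
          \<le> (Cw i * M i + norm (Dg i xs)) * ?D"
        by (intro norm_triangle_le) (simp add: algebra_simps)
    qed
    have 3: "norm (\<Sum>i\<in>{1..mI} - active. (lam i - lams i) *\<^sub>R Dg i xs)
        \<le> (\<Sum>i\<in>{1..mI} - active. Ca i * norm (Dg i xs) * ?D)"
    proof (rule sum_norm_le)
      fix i assume i: "i \<in> {1..mI} - active"
      show "norm ((lam i - lams i) *\<^sub>R Dg i xs) \<le> Ca i * norm (Dg i xs) * ?D"
        using mult_right_mono[OF bnd(1)[OF d i], of "norm (Dg i xs)"] by (simp add: mult_ac)
    qed
    have tri: "norm (- u - v - w) \<le> norm u + norm v + norm w" for u v w :: "real ^ 'n"
      using norm_triangle_ineq4[of "- u - v" w] norm_triangle_ineq4[of "- u" v] by simp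
    have "norm (pdgd_x \<rho> Df mI g Dg mE A (x, lam, nu) + force lam nu)
        \<le> l * ?D + (\<Sum>i\<in>{1..mI}. (Cw i * M i + norm (Dg i xs)) * ?D)
          + (\<Sum>i\<in>{1..mI} - active. Ca i * norm (Dg i xs) * ?D)"
      unfolding pdgd_x_plus_force using tri 1 2 3 by (smt (verit))
    also have "\<dots> \<le> C * ?D"
      using defect_bounds(1)[of x lam] by (simp add: C_def algebra_simps sum_distrib_left sum_distrib_right sum.distrib)
    finally show "norm (pdgd_x \<rho> Df mI g Dg mE A (x, lam, nu) + force lam nu) \<le> C * ?D" .
  qed
qed

text \<open>The derivative of \<^const>\<open>force\<close> along the dynamics.\<close>

definition force_rate :: "real ^ 'n \<Rightarrow> (nat \<Rightarrow> real) \<Rightarrow> real ^ 'n" where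
  "force_rate x lam = (\<Sum>i\<in>active. (gap x lam i / \<rho>) *\<^sub>R Dg i xs) + (\<Sum>j\<in>{1..mE}. (A j \<bullet> (x - xs)) *\<^sub>R A j)"

lemma force_rate_bound:
  obtains C where "C > 0" and "\<And>x lam. norm (force_rate x lam) \<le> C * defect x lam"
proof
  let ?C = "1 + (\<Sum>i\<in>active. norm (Dg i xs) / \<rho>) + (\<Sum>j\<in>{1..mE}. (norm (A j))\<^sup>2)"
  show "?C > 0"
    using rho_pos by (intro add_pos_nonneg sum_nonneg) auto
  fix x lam
  let ?D = "defect x lam"
  have "norm (\<Sum>i\<in>active. (gap x lam i / \<rho>) *\<^sub>R Dg i xs) \<le> (\<Sum>i\<in>active. norm (Dg i xs) / \<rho> * ?D)"
  proof (rule sum_norm_le)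
    fix i assume "i \<in> active"
    then have "\<bar>gap x lam i\<bar> \<le> ?D"
      using active_subset by (intro defect_bounds(3)) auto
    then show "norm ((gap x lam i / \<rho>) *\<^sub>R Dg i xs) \<le> norm (Dg i xs) / \<rho> * ?D"
      using rho_pos mult_right_mono[of "\<bar>gap x lam i\<bar>" ?D "norm (Dg i xs) / \<rho>"] by (simp add: mult_ac)
  qed
  moreover have "norm (\<Sum>j\<in>{1..mE}. (A j \<bullet> (x - xs)) *\<^sub>R A j) \<le> (\<Sum>j\<in>{1..mE}. (norm (A j))\<^sup>2 * ?D)"
  proof (rule sum_norm_le)
    fix j
    have "\<bar>A j \<bullet> (x - xs)\<bar> \<le> norm (A j) * ?D"
      using Cauchy_Schwarz_ineq2[of "A j" "x - xs"] mult_left_mono[OF defect_bounds(2), of "norm (A j)" x lam]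
      by simp
    then show "norm ((A j \<bullet> (x - xs)) *\<^sub>R A j) \<le> (norm (A j))\<^sup>2 * ?D"
      using mult_right_mono[of "\<bar>A j \<bullet> (x - xs)\<bar>" "norm (A j) * ?D" "norm (A j)"]
      by (simp add: power2_eq_square mult_ac)
  qed
  ultimately have "norm (force_rate x lam)
      \<le> (\<Sum>i\<in>active. norm (Dg i xs) / \<rho> * ?D) + (\<Sum>j\<in>{1..mE}. (norm (A j))\<^sup>2 * ?D)"
    unfolding force_rate_def by (rule norm_triangle_mono)
  also have "\<dots> \<le> ?C * ?D"
    using defect_bounds(1)[of x lam]
    by (simp add: algebra_simps sum_distrib_left sum_distrib_right)
  finally show "norm (force_rate x lam) \<le> ?C * ?D" .
qed

lemma force_bound:
  obtains C where "C > 0" and "\<And>x lam nu. norm (force lam nu) \<le> C * dist_kkt x lam nu"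
proof
  let ?C = "1 + (\<Sum>i\<in>active. norm (Dg i xs)) + (\<Sum>j\<in>{1..mE}. norm (A j))"
  show "?C > 0"
    by (intro add_pos_nonneg sum_nonneg) auto
  fix x lam nu
  let ?d = "dist_kkt x lam nu"
  have "norm (\<Sum>i\<in>active. (lam i - lams i) *\<^sub>R Dg i xs) \<le> (\<Sum>i\<in>active. norm (Dg i xs) * ?d)"
  proof (rule sum_norm_le)
    fix i assume "i \<in> active"
    then have "\<bar>lam i - lams i\<bar> \<le> ?d"
      using active_subset by (intro dist_kkt_bounds(2)) auto
    then show "norm ((lam i - lams i) *\<^sub>R Dg i xs) \<le> norm (Dg i xs) * ?d"
      using mult_right_mono[of "\<bar>lam i - lams i\<bar>" ?d "norm (Dg i xs)"] by (simp add: mult_ac)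
  qed
  moreover have "norm (\<Sum>j\<in>{1..mE}. (nu j - nus j) *\<^sub>R A j) \<le> (\<Sum>j\<in>{1..mE}. norm (A j) * ?d)"
  proof (rule sum_norm_le)
    fix j assume "j \<in> {1..mE}"
    then have "\<bar>nu j - nus j\<bar> \<le> ?d"
      by (rule dist_kkt_bounds(3))
    then show "norm ((nu j - nus j) *\<^sub>R A j) \<le> norm (A j) * ?d"
      using mult_right_mono[of "\<bar>nu j - nus j\<bar>" ?d "norm (A j)"] by (simp add: mult_ac)
  qed
  ultimately have "norm (force lam nu)
      \<le> (\<Sum>i\<in>active. norm (Dg i xs) * ?d) + (\<Sum>j\<in>{1..mE}. norm (A j) * ?d)"
    unfolding force_def by (rule norm_triangle_mono)
  also have "\<dots> \<le> ?C * ?d"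
    using order_trans[OF norm_ge_zero dist_kkt_bounds(1)[of x lam nu]]
    by (simp add: algebra_simps sum_distrib_left sum_distrib_right)
  finally show "norm (force lam nu) \<le> ?C * ?d" .
qed

text \<open>The error of \<open>x\<close> and the inactive multipliers are bounded by the defect, all other
  multipliers by the force.\<close>

lemma dist_le_defect_force:
  assumes h: "h > 0"
  obtains K where "K > 0"
    and "\<And>x lam nu. dist_kkt x lam nu \<le> h \<Longrightarrow>
      (dist_kkt x lam nu)\<^sup>2 \<le> K * ((defect x lam)\<^sup>2 + (norm (force lam nu))\<^sup>2)"
proof -
  obtain Ca where Ca: "\<And>x lam nu i. dist_kkt x lam nu \<le> h \<Longrightarrow> i \<in> {1..mI} - active \<Longrightarrow>
      \<bar>lam i - lams i\<bar> \<le> Ca i * defect x lam"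
    by (rule local_bounds[OF h]) (rule that)
  obtain B where B: "B > 0"
    "\<And>lam nu. (\<Sum>i\<in>active. (lam i - lams i)\<^sup>2) + (\<Sum>j\<in>{1..mE}. (nu j - nus j)\<^sup>2)
        \<le> B * (norm (force lam nu))\<^sup>2"
    using multipliers_le_force by blast
  define S where "S = (\<Sum>i\<in>{1..mI} - active. (Ca i)\<^sup>2)"
  have S: "S \<ge> 0"
    by (simp add: S_def sum_nonneg)
  show thesis
  proof (rule that)
    show "1 + S + B > 0"
      using S B(1) by simp
    fix x lam nu assume d: "dist_kkt x lam nu \<le> h"
    let ?D = "defect x lam" and ?P = "norm (force lam nu)"
    have "(lam i - lams i)\<^sup>2 \<le> (Ca i)\<^sup>2 * ?D\<^sup>2" if "i \<in> {1..mI} - active" for i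
      using power_mono[OF Ca[OF d that] abs_ge_zero, of 2] by (simp add: power_mult_distrib)
    then have in_le: "(\<Sum>i\<in>{1..mI} - active. (lam i - lams i)\<^sup>2) \<le> S * ?D\<^sup>2"
      unfolding S_def sum_distrib_right by (rule sum_mono)
    have x_le: "(norm (x - xs))\<^sup>2 \<le> ?D\<^sup>2"
      using defect_bounds(2) by (rule power_mono) simp
    have "(dist_kkt x lam nu)\<^sup>2 = (norm (x - xs))\<^sup>2 + (\<Sum>i\<in>{1..mI} - active. (lam i - lams i)\<^sup>2)
        + ((\<Sum>i\<in>active. (lam i - lams i)\<^sup>2) + (\<Sum>j\<in>{1..mE}. (nu j - nus j)\<^sup>2))"
      unfolding dist_kkt_sq
      using sum.subset_diff[OF active_subset, of "\<lambda>i. (lam i - lams i)\<^sup>2"] by simp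
    also have "\<dots> \<le> ?D\<^sup>2 + S * ?D\<^sup>2 + B * ?P\<^sup>2"
      using x_le in_le B(2) by (intro add_mono)
    also have "\<dots> \<le> (1 + S + B) * (?D\<^sup>2 + ?P\<^sup>2)"
      using S B(1) by (simp add: algebra_simps)
    finally show "(dist_kkt x lam nu)\<^sup>2 \<le> (1 + S + B) * (?D\<^sup>2 + ?P\<^sup>2)" .
  qed
qed

section \<open>Trajectories\<close>

context
  fixes x :: "real \<Rightarrow> real ^ 'n" and lam nu :: "real \<Rightarrow> nat \<Rightarrow> real"
  assumes traj: "pdgd_trajectory \<rho> Df mI g Dg mE A b x lam nu"
begin

lemma x_derivative:
  assumes "t \<ge> 0"
  shows "((\<lambda>t. x t - xs) has_vector_derivative pdgd_x \<rho> Df mI g Dg mE A (x t, lam t, nu t))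
      (at t within {0..})"
proof -
  have "(x has_vector_derivative pdgd_x \<rho> Df mI g Dg mE A (x t, lam t, nu t)) (at t within {0..})"
    using traj assms unfolding pdgd_trajectory_def by blast
  from has_vector_derivative_diff[OF this has_vector_derivative_const, of xs] show ?thesis
    by simp
qed

lemma lam_derivative:
  assumes "t \<ge> 0" and "i \<in> {1..mI}"
  shows "((\<lambda>t. lam t i - lams i) has_real_derivative pdgd_lambda \<rho> g (x t, lam t, nu t) i)
      (at t within {0..})"
proof -
  have "((\<lambda>t. lam t i) has_real_derivative pdgd_lambda \<rho> g (x t, lam t, nu t) i) (at t within {0..})"
    using traj assms unfolding pdgd_trajectory_def by blast
  from DERIV_diff[OF this DERIV_const, of "lams i"] show ?thesis
    by simp
qed

lemma nu_derivative:
  assumes "t \<ge> 0" and "j \<in> {1..mE}"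
  shows "((\<lambda>t. nu t j - nus j) has_real_derivative pdgd_nu A b (x t, lam t, nu t) j)
      (at t within {0..})"
proof -
  have "((\<lambda>t. nu t j) has_real_derivative pdgd_nu A b (x t, lam t, nu t) j) (at t within {0..})"
    using traj assms unfolding pdgd_trajectory_def by blast
  from DERIV_diff[OF this DERIV_const, of "nus j"] show ?thesis
    by simp
qed

definition dist_rate :: "real \<Rightarrow> real" where
  "dist_rate t = 2 * (pdgd_x \<rho> Df mI g Dg mE A (x t, lam t, nu t) \<bullet> (x t - xs)
     + (\<Sum>i\<in>{1..mI}. (lam t i - lams i) * pdgd_lambda \<rho> g (x t, lam t, nu t) i)
     + (\<Sum>j\<in>{1..mE}. (nu t j - nus j) * pdgd_nu A b (x t, lam t, nu t) j))"

lemma dist_derivative: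
  assumes t: "t \<ge> 0"
  shows "((\<lambda>t. (dist_kkt (x t) (lam t) (nu t))\<^sup>2) has_real_derivative dist_rate t) (at t within {0..})"
proof -
  let ?X = "pdgd_x \<rho> Df mI g Dg mE A (x t, lam t, nu t)"
  let ?L = "pdgd_lambda \<rho> g (x t, lam t, nu t)" and ?N = "pdgd_nu A b (x t, lam t, nu t)"
  have sq: "((\<lambda>t. (u t)\<^sup>2) has_real_derivative 2 * (u t * u')) (at t within {0..})"
    if "(u has_real_derivative u') (at t within {0..})" for u u'
    using DERIV_power[OF that, of 2] by (simp add: mult_ac)
  have "((\<lambda>t. (x t - xs) \<bullet> (x t - xs) + (\<Sum>i\<in>{1..mI}. (lam t i - lams i)\<^sup>2)
        + (\<Sum>j\<in>{1..mE}. (nu t j - nus j)\<^sup>2))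
      has_real_derivative (?X \<bullet> (x t - xs) + (x t - xs) \<bullet> ?X)
        + (\<Sum>i\<in>{1..mI}. 2 * ((lam t i - lams i) * ?L i))
        + (\<Sum>j\<in>{1..mE}. 2 * ((nu t j - nus j) * ?N j))) (at t within {0..})"
    by (intro DERIV_add DERIV_sum has_real_derivative_inner sq x_derivative lam_derivative
        nu_derivative t)
  then show ?thesis
    unfolding dist_kkt_sq dist_rate_def
    by (simp only: power2_norm_eq_inner inner_commute[of "x t - xs" ?X] sum_distrib_left
        distrib_left mult_2)
qed

lemma dist_rate_le: "dist_rate t \<le> - (2 * min \<mu> (1 / \<rho>)) * (defect (x t) (lam t))\<^sup>2"
  using mult_left_mono[OF dissipation, of 2 "x t" "lam t" "nu t"]
  by (simp only: dist_rate_def mult_minus_left mult_minus_right mult.assoc zero_le_numeral)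

lemma dist_nonincreasing:
  assumes "t \<ge> 0"
  shows "dist_kkt (x t) (lam t) (nu t) \<le> dist_kkt (x 0) (lam 0) (nu 0)"
proof -
  have "dist_rate s \<le> 0" for s
    by (rule order_trans[OF dist_rate_le]) (use rho_pos mu_pos in \<open>simp add: mult_le_0_iff\<close>)
  then have "(dist_kkt (x t) (lam t) (nu t))\<^sup>2 \<le> (dist_kkt (x 0) (lam 0) (nu 0))\<^sup>2"
    using assms
    by (intro halfline_nonincreasing[where V' = dist_rate
          and V = "\<lambda>t. (dist_kkt (x t) (lam t) (nu t))\<^sup>2"] dist_derivative)
  then show ?thesis
    using order_trans[OF norm_ge_zero dist_kkt_bounds(1)] by (rule power2_le_imp_le)
qed

lemma force_derivative:
  assumes t: "t \<ge> 0"
  shows "((\<lambda>t. force (lam t) (nu t)) has_vector_derivative force_rate (x t) (lam t)) (at t within {0..})"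
proof -
  have scale: "((\<lambda>t. u t *\<^sub>R v) has_vector_derivative u' *\<^sub>R v) (at t within {0..})"
    if "(u has_real_derivative u') (at t within {0..})" for u u' and v :: "real ^ 'n"
    using has_vector_derivative_scaleR[OF that has_vector_derivative_const, of v] by simp
  have "((\<lambda>t. lam t i - lams i) has_real_derivative gap (x t) (lam t) i / \<rho>) (at t within {0..})"
    if "i \<in> active" for i
    using lam_derivative[OF t, of i] that active_subset unfolding pdgd_lambda_eq_gap by blast
  moreover have "((\<lambda>t. nu t j - nus j) has_real_derivative A j \<bullet> (x t - xs)) (at t within {0..})"
    if "j \<in> {1..mE}" for j
    using nu_derivative[OF t that] A_xs[OF that] by (simp add: inner_diff_right)
  ultimately show ?thesis
    unfolding force_def force_rate_def
    by (intro has_vector_derivative_add has_vector_derivative_sum scale)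
qed

end

text \<open>Since the distance does not increase, the bounds on the ball of radius \<open>h\<close> are available at
  all times. Passing from squares to distances halves the rate.\<close>

theorem semiglobal_exponential_decay:
  assumes h: "h > 0"
  obtains \<beta> where "\<beta> > 0"
    and "\<And>x lam nu t. \<lbrakk>pdgd_trajectory \<rho> Df mI g Dg mE A b x lam nu;
        dist_kkt (x 0) (lam 0) (nu 0) \<le> h; t \<ge> 0\<rbrakk>
      \<Longrightarrow> dist_kkt (x t) (lam t) (nu t) \<le> 2 * exp (- \<beta> * t) * dist_kkt (x 0) (lam 0) (nu 0)"
proof -
  obtain C1 where C1: "C1 > 0" "\<And>x lam nu. dist_kkt x lam nu \<le> h \<Longrightarrow>
      norm (pdgd_x \<rho> Df mI g Dg mE A (x, lam, nu) + force lam nu) \<le> C1 * defect x lam"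
    using pdgd_x_force_bound[OF h] by blast
  obtain C2 where C2: "C2 > 0" "\<And>x lam. norm (force_rate x lam) \<le> C2 * defect x lam"
    using force_rate_bound by blast
  obtain K1 where K1: "K1 > 0" "\<And>x lam nu. dist_kkt x lam nu \<le> h \<Longrightarrow>
      (dist_kkt x lam nu)\<^sup>2 \<le> K1 * ((defect x lam)\<^sup>2 + (norm (force lam nu))\<^sup>2)"
    using dist_le_defect_force[OF h] by blast
  obtain K2 where K2: "K2 > 0" "\<And>x lam nu. norm (force lam nu) \<le> K2 * dist_kkt x lam nu"
    using force_bound by blast
  define m where "m = 2 * min \<mu> (1 / \<rho>)"
  have m: "m > 0"
    using rho_pos mu_pos by (simp add: m_def)
  have CK: "max C1 C2 > 0" "max K1 K2 > 0"
    using C1(1) K1(1) by (simp_all add: less_max_iff_disj)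
  define \<beta> where "\<beta> = decay_rate m (max C1 C2) (max K1 K2)"
  have \<beta>: "\<beta> > 0"
    using m CK by (simp add: \<beta>_def decay_rate_pos)
  show thesis
  proof (rule that)
    show "\<beta> / 2 > 0"
      using \<beta> by simp
    fix x lam nu and t :: real
    assume traj: "pdgd_trajectory \<rho> Df mI g Dg mE A b x lam nu"
      and init: "dist_kkt (x 0) (lam 0) (nu 0) \<le> h" and t: "t \<ge> 0"
    let ?d = "\<lambda>t. dist_kkt (x t) (lam t) (nu t)" and ?D = "\<lambda>t. defect (x t) (lam t)"
    have d0: "0 \<le> ?d t" for t
      using order_trans[OF norm_ge_zero dist_kkt_bounds(1)] .
    have dh: "?d t \<le> h" if "t \<ge> 0" for t
      using dist_nonincreasing[OF traj that] init by linarith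
    have "(?d t)\<^sup>2 \<le> 3 * exp (- \<beta> * t) * (?d 0)\<^sup>2"
      unfolding \<beta>_def
    proof (rule decay_by_cross_term[OF m CK x_derivative[OF traj] force_derivative[OF traj]
          dist_derivative[OF traj]
          dist_rate_le[OF traj, folded m_def] _ _ _ _ _ t])
      fix s :: real assume s: "s \<ge> 0"
      show "norm (x s - xs) \<le> ?D s"
        by (rule defect_bounds)
      show "norm (pdgd_x \<rho> Df mI g Dg mE A (x s, lam s, nu s) + force (lam s) (nu s))
          \<le> max C1 C2 * ?D s"
        using C1(2)[OF dh[OF s]] mult_right_mono[of C1 "max C1 C2" "?D s"] defect_bounds(1)
        by (meson max.cobounded1 order_trans)
      show "norm (force_rate (x s) (lam s)) \<le> max C1 C2 * ?D s"
        using C2(2) mult_right_mono[of C2 "max C1 C2" "?D s"] defect_bounds(1)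
        by (meson max.cobounded2 order_trans)
      show "(?d s)\<^sup>2 \<le> max K1 K2 * ((?D s)\<^sup>2 + (norm (force (lam s) (nu s)))\<^sup>2)"
        using K1(2)[OF dh[OF s]]
        by (rule order_trans) (intro mult_right_mono, auto)
      have "norm (x s - xs) * norm (force (lam s) (nu s)) \<le> ?d s * (K2 * ?d s)"
        using dist_kkt_bounds(1) K2(2) d0 by (intro mult_mono) auto
      also have "\<dots> = K2 * (?d s)\<^sup>2"
        by (simp only: power2_eq_square mult_ac)
      also have "\<dots> \<le> max K1 K2 * (?d s)\<^sup>2"
        by (intro mult_right_mono) auto
      finally show "norm (x s - xs) * norm (force (lam s) (nu s)) \<le> max K1 K2 * (?d s)\<^sup>2" .
    qed
    \<comment> \<open>Rounding 3 up to a square makes the final constant 2.\<close>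
    also have "\<dots> \<le> 4 * exp (- \<beta> * t) * (?d 0)\<^sup>2"
      by (intro mult_right_mono) auto
    also have "\<dots> = (2 * exp (- (\<beta> / 2) * t) * ?d 0)\<^sup>2"
      by (simp only: power_mult_distrib exp_double[symmetric]) simp
    finally show "?d t \<le> 2 * exp (- (\<beta> / 2) * t) * ?d 0"
      by (rule power2_le_imp_le) (simp add: d0)
  qed
qed

end

section \<open>Semi-global exponential stability\<close>

theorem corollary1:
  fixes f :: "real ^ 'n \<Rightarrow> real" and Df :: "real ^ 'n \<Rightarrow> real ^ 'n"
    and g :: "nat \<Rightarrow> real ^ 'n \<Rightarrow> real" and Dg :: "nat \<Rightarrow> real ^ 'n \<Rightarrow> real ^ 'n"
    and A :: "nat \<Rightarrow> real ^ 'n" and b :: "nat \<Rightarrow> real"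
    and mI mE :: nat and \<rho> \<mu> l :: real
    and xs :: "real ^ 'n" and lams nus :: "nat \<Rightarrow> real"
  assumes rho_pos: "\<rho> > 0"
    and f_C1: "has_continuous_gradient f Df"
    and f_convex: "convex_on UNIV f"
    and g_C1: "\<And>i. i \<in> {1..mI} \<Longrightarrow> has_continuous_gradient (g i) (Dg i)"
    and g_convex: "\<And>i. i \<in> {1..mI} \<Longrightarrow> convex_on UNIV (g i)"
    and feasible: "feasible_set mI g mE A b \<noteq> {}"
    and mu_pos: "\<mu> > 0"
    and f_strongly_convex: "strongly_convex \<mu> f"
    and xs_optimal: "is_arg_min f (\<lambda>x. x \<in> feasible_set mI g mE A b) xs"
    and licq: "LICQ mI g Dg mE A xs"
    and nonempty: "card (active_set mI g xs) + mE > 0"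
    and kkt: "KKT Df mI g Dg mE A b (xs, lams, nus)"
    and Df_lipschitz: "l-lipschitz_on UNIV Df"
    and Dg_bounds: "\<exists>Lg Mg :: nat \<Rightarrow> real \<Rightarrow> real. \<forall>i\<in>{1..mI}.
          mono_on {0..} (Lg i) \<and> mono_on {0..} (Mg i) \<and>
          (\<forall>d0\<ge>0. 0 \<le> Lg i d0 \<and> 0 \<le> Mg i d0 \<and>
             (\<forall>x\<in>cball xs d0. norm (Dg i x) \<le> Lg i d0) \<and>
             (Mg i d0)-lipschitz_on (cball xs d0) (Dg i))"
  shows "pdgd_equilibrium \<rho> Df mI g Dg mE A b (xs, lams, nus) \<and>
    (\<forall>h>0. \<exists>M>0. \<exists>\<beta>>0. \<forall>x lam nu.
        pdgd_trajectory \<rho> Df mI g Dg mE A b x lam nu \<longrightarrow>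
        (\<forall>i\<in>{1..mI}. 0 \<le> lam 0 i) \<longrightarrow>
        pd_dist mI mE (x 0, lam 0, nu 0) (xs, lams, nus) \<le> h \<longrightarrow>
        (\<forall>t\<ge>0. pd_dist mI mE (x t, lam t, nu t) (xs, lams, nus)
                  \<le> M * exp (- \<beta> * t) * pd_dist mI mE (x 0, lam 0, nu 0) (xs, lams, nus)))"
proof -
  interpret regular_kkt_point f Df g Dg A b mI mE \<rho> \<mu> l xs lams nus
  proof
    show "\<exists>L M. 0 \<le> L \<and> (\<forall>x\<in>cball xs h. norm (Dg i x) \<le> L) \<and> M-lipschitz_on (cball xs h) (Dg i)"
      if "i \<in> {1..mI}" "h \<ge> 0" for i h
      using Dg_bounds that by blast
  qed (use assms in \<open>auto simp: has_continuous_gradient_def simp del: KKT.simps\<close>)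
  show ?thesis
  proof (intro conjI allI impI)
    show "pdgd_equilibrium \<rho> Df mI g Dg mE A b (xs, lams, nus)"
      by (rule equilibrium)
  next
    fix h :: real assume "h > 0"
    then obtain \<beta> where "\<beta> > 0"
      and "\<And>x lam nu t. \<lbrakk>pdgd_trajectory \<rho> Df mI g Dg mE A b x lam nu;
        dist_kkt (x 0) (lam 0) (nu 0) \<le> h; t \<ge> 0\<rbrakk>
      \<Longrightarrow> dist_kkt (x t) (lam t) (nu t) \<le> 2 * exp (- \<beta> * t) * dist_kkt (x 0) (lam 0) (nu 0)"
      using semiglobal_exponential_decay by blast
    then show "\<exists>M>0. \<exists>\<beta>>0. \<forall>x lam nu.
        pdgd_trajectory \<rho> Df mI g Dg mE A b x lam nu \<longrightarrow>
        (\<forall>i\<in>{1..mI}. 0 \<le> lam 0 i) \<longrightarrow>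
        pd_dist mI mE (x 0, lam 0, nu 0) (xs, lams, nus) \<le> h \<longrightarrow>
        (\<forall>t\<ge>0. pd_dist mI mE (x t, lam t, nu t) (xs, lams, nus)
                  \<le> M * exp (- \<beta> * t) * pd_dist mI mE (x 0, lam 0, nu 0) (xs, lams, nus))"
      by (intro exI[of _ 2] exI[of _ \<beta>] conjI allI impI) simp_all
  qed
qed

end
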